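(* Let $\omega$ be a real number such that $x=e^{i\omega}$ (equivalently $\cos(\omega)$) is transcendental. Let $S=R_y^{\pi/2}$, and define the rotations $X=R_x^{\omega}$ and $V=S^{-1}XS=R_z^{\omega}$. Then the subgroup of $SO(3)$ generated by $X$ and $V$ is the free group with those generators.
   Context: $R_x^{\theta}, R_y^{\theta}, R_z^{\theta}\in SO(3)$ denote the rotations of Euclidean 3-space by angle $\theta$ (right-hand rule) about the $x$-, $y$- and $z$-axis. *)

theory Defs
  imports "HOL-Analysis.Analysis" "HOL-Algebra.Generated_Groups"
    "HOL-Computational_Algebra.Polynomial"
begin

section \<open>Free groups as groups of reduced words\<close>

text \<open>The letter \<open>(a, True)\<close> stands for the generator \<open>a\<close>, the letter
  \<open>(a, False)\<close> for its formal inverse.\<close>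

type_synonym 'a letter = "'a \<times> bool"

definition inv_letter :: "'a letter \<Rightarrow> 'a letter" where
  "inv_letter l = (fst l, \<not> snd l)"

definition reduced_word :: "'a letter list \<Rightarrow> bool" where
  "reduced_word w \<longleftrightarrow> successively (\<lambda>k l. l \<noteq> inv_letter k) w"

text \<open>\<open>push l w\<close> is the reduced form of \<open>l # w\<close>, for reduced \<open>w\<close>.\<close>

definition push :: "'a letter \<Rightarrow> 'a letter list \<Rightarrow> 'a letter list" where
  "push l w = (case w of [] \<Rightarrow> [l] | k # w' \<Rightarrow> if k = inv_letter l then w' else l # w)"

text \<open>\<open>foldr push u v\<close> is the reduced form of the concatenation \<open>u @ v\<close>.\<close>

definition free_group :: "'a set \<Rightarrow> 'a letter list monoid" where
  "free_group A =
    \<lparr>carrier = {w \<in> lists (A \<times> UNIV). reduced_word w},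
     mult = (\<lambda>u v. foldr push u v),
     one = []\<rparr>"

definition eval_letter :: "('a, 'm) monoid_scheme \<Rightarrow> 'a letter \<Rightarrow> 'a" where
  "eval_letter G l = (if snd l then fst l else inv\<^bsub>G\<^esub> (fst l))"

definition eval_word :: "('a, 'm) monoid_scheme \<Rightarrow> 'a letter list \<Rightarrow> 'a" where
  "eval_word G w = foldr (\<lambda>l g. eval_letter G l \<otimes>\<^bsub>G\<^esub> g) w \<one>\<^bsub>G\<^esub>"

text \<open>\<open>G\<close> is free with free generating set \<open>B\<close>: the canonical map from the free group
  on \<open>B\<close> to \<open>G\<close>, which is the identity on generators, is an isomorphism.\<close>

definition is_free_group_on :: "('a, 'm) monoid_scheme \<Rightarrow> 'a set \<Rightarrow> bool" where
  "is_free_group_on G B \<longleftrightarrow>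
     B \<subseteq> carrier G \<and> eval_word G \<in> iso (free_group B) G"

lemma inv_letter_invol [simp]: "inv_letter (inv_letter l) = l"
  by (simp add: inv_letter_def)

lemma reduced_Nil [simp]: "reduced_word []"
  by (simp add: reduced_word_def)

lemma reduced_Cons: "reduced_word (l # w) \<longleftrightarrow> reduced_word w \<and> (w = [] \<or> hd w \<noteq> inv_letter l)"
  by (cases w) (auto simp: reduced_word_def)

lemma reduced_push: "reduced_word w \<Longrightarrow> reduced_word (push l w)"
  by (auto simp: push_def reduced_Cons split: list.split)

lemma reduced_foldr_push: "reduced_word v \<Longrightarrow> reduced_word (foldr push u v)"
  by (induction u) (auto intro: reduced_push)

lemma set_push: "set (push l w) \<subseteq> insert l (set w)"
  by (auto simp: push_def split: list.splits if_splits)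

lemma set_foldr_push: "set (foldr push u v) \<subseteq> set u \<union> set v"
proof (induction u)
  case (Cons l u)
  then show ?case using set_push[of l "foldr push u v"] by auto
qed simp

lemma foldr_push_in_lists: "u \<in> lists L \<Longrightarrow> v \<in> lists L \<Longrightarrow> foldr push u v \<in> lists L"
  using set_foldr_push[of u v] by (auto simp: lists_eq_set)

lemma push_inv_letter: "reduced_word w \<Longrightarrow> push l (push (inv_letter l) w) = w"
  by (cases w) (auto simp: push_def reduced_Cons split: list.split)

lemma foldr_push_push:
  assumes "reduced_word v"
  shows "foldr push (push l u) v = push l (foldr push u v)"
proof (cases "\<exists>u'. u = inv_letter l # u'")
  case True
  then obtain u' where u: "u = inv_letter l # u'" by blast
  show ?thesis
    using push_inv_letter[OF reduced_foldr_push[OF assms, of u'], of l]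
    by (simp add: u push_def[of l "inv_letter l # u'"])
next
  case False
  then have "push l u = l # u"
    by (auto simp: push_def split: list.split)
  then show ?thesis by simp
qed

lemma foldr_push_assoc:
  "reduced_word w \<Longrightarrow> foldr push (foldr push u v) w = foldr push u (foldr push v w)"
  by (induction u) (simp_all add: foldr_push_push)

lemma foldr_push_Nil: "reduced_word u \<Longrightarrow> foldr push u [] = u"
  by (induction u) (auto simp: reduced_Cons push_def split: list.split)

lemma foldr_push_inverse:
  "foldr push (rev (map inv_letter u)) u = []"
  by (induction u) (simp_all add: push_def)

lemma inv_letter_inject [simp]: "inv_letter k = inv_letter l \<longleftrightarrow> k = l"
  by (metis inv_letter_invol)

lemma reduced_inverse: "reduced_word u \<Longrightarrow> reduced_word (rev (map inv_letter u))"
  unfolding reduced_word_def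
  by (auto simp: successively_map elim!: successively_mono)

lemma group_free_group: "group (free_group A)"
proof (rule groupI)
  fix x assume x: "x \<in> carrier (free_group A)"
  let ?y = "rev (map inv_letter x)"
  have "?y \<in> carrier (free_group A)"
    using x reduced_inverse[of x] by (fastforce simp: free_group_def inv_letter_def)
  moreover have "?y \<otimes>\<^bsub>free_group A\<^esub> x = \<one>\<^bsub>free_group A\<^esub>"
    by (simp add: free_group_def foldr_push_inverse)
  ultimately show "\<exists>y\<in>carrier (free_group A). y \<otimes>\<^bsub>free_group A\<^esub> x = \<one>\<^bsub>free_group A\<^esub>"
    by blast
qed (simp_all add: free_group_def foldr_push_assoc reduced_foldr_push foldr_push_in_lists
       del: in_lists_conv_set)

context group
begin

lemma eval_letter_closed: "fst l \<in> carrier G \<Longrightarrow> eval_letter G l \<in> carrier G"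
  by (simp add: eval_letter_def)

lemma eval_word_closed: "w \<in> lists (carrier G \<times> UNIV) \<Longrightarrow> eval_word G w \<in> carrier G"
  by (induction w) (auto simp: eval_word_def eval_letter_closed)

lemma eval_letter_inv_letter:
  "fst l \<in> carrier G \<Longrightarrow> eval_letter G (inv_letter l) = inv (eval_letter G l)"
  by (simp add: eval_letter_def inv_letter_def)

lemma eval_word_push:
  assumes "fst l \<in> carrier G" "w \<in> lists (carrier G \<times> UNIV)"
  shows "eval_word G (push l w) = eval_letter G l \<otimes> eval_word G w"
proof (cases "\<exists>w'. w = inv_letter l # w'")
  case True
  then obtain w' where w: "w = inv_letter l # w'" by blast
  have "eval_word G w' \<in> carrier G"
    using assms(2) by (auto intro!: eval_word_closed simp: w)
  with assms(1) show ?thesis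
    by (simp add: w push_def eval_word_def eval_letter_inv_letter eval_letter_closed
        m_assoc[symmetric])
next
  case False
  then have "push l w = l # w"
    by (auto simp: push_def split: list.split)
  then show ?thesis by (simp add: eval_word_def)
qed

lemma eval_word_foldr_push:
  assumes "u \<in> lists (carrier G \<times> UNIV)" "v \<in> lists (carrier G \<times> UNIV)"
  shows "eval_word G (foldr push u v) = eval_word G u \<otimes> eval_word G v"
  using assms(1)
proof induction
  case Nil
  show ?case using eval_word_closed[OF assms(2)] by (simp add: eval_word_def)
next
  case (Cons l u)
  have "eval_word G (foldr push (l # u) v) = eval_letter G l \<otimes> eval_word G (foldr push u v)"
    using Cons.hyps foldr_push_in_lists[OF Cons.hyps(2) assms(2)]
    by (simp add: eval_word_push mem_Times_iff del: in_lists_conv_set)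
  also have "\<dots> = eval_word G (l # u) \<otimes> eval_word G v"
    using Cons eval_word_closed[OF Cons.hyps(2)] eval_word_closed[OF assms(2)]
    by (auto simp: eval_word_def eval_letter_closed m_assoc)
  finally show ?case .
qed

lemma eval_word_hom:
  assumes "B \<subseteq> carrier G"
  shows "eval_word G \<in> hom (free_group B) G"
proof -
  have "lists (B \<times> (UNIV :: bool set)) \<subseteq> lists (carrier G \<times> (UNIV :: bool set))"
    using assms by (intro lists_mono) auto
  then have "w \<in> lists (carrier G \<times> (UNIV :: bool set))" if "w \<in> lists (B \<times> (UNIV :: bool set))" for w
    using that by blast
  then show ?thesis
    by (intro homI)
      (simp_all add: free_group_def eval_word_closed eval_word_foldr_push
        del: in_lists_conv_set)
qed

lemma eval_word_generator: "b \<in> carrier G \<Longrightarrow> eval_word G [(b, True)] = b"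
  by (simp add: eval_word_def eval_letter_def)

end


section \<open>Rotations of Euclidean 3-space\<close>

definition SO3 :: "(real^3^3) monoid" where
  "SO3 = \<lparr>carrier = {A. rotation_matrix A}, mult = (**), one = mat 1\<rparr>"

text \<open>The matrices are given by their rows and act on column vectors by \<open>(*v)\<close>.\<close>

definition rot_x :: "real \<Rightarrow> real^3^3" where
  "rot_x \<theta> = vector
     [vector [1, 0, 0],
      vector [0, cos \<theta>, - sin \<theta>],
      vector [0, sin \<theta>, cos \<theta>]]"

definition rot_y :: "real \<Rightarrow> real^3^3" where
  "rot_y \<theta> = vector
     [vector [cos \<theta>, 0, sin \<theta>],
      vector [0, 1, 0],
      vector [- sin \<theta>, 0, cos \<theta>]]"

definition rot_z :: "real \<Rightarrow> real^3^3" where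
  "rot_z \<theta> = vector
     [vector [cos \<theta>, - sin \<theta>, 0],
      vector [sin \<theta>, cos \<theta>, 0],
      vector [0, 0, 1]]"

lemma group_SO3: "group SO3"
proof (rule groupI)
  fix A assume "A \<in> carrier SO3"
  then have A: "orthogonal_matrix A" "det A = 1"
    by (auto simp: SO3_def rotation_matrix_def)
  then have "transpose A \<in> carrier SO3"
    by (simp add: SO3_def rotation_matrix_def orthogonal_matrix_transpose)
  moreover have "transpose A \<otimes>\<^bsub>SO3\<^esub> A = \<one>\<^bsub>SO3\<^esub>"
    using A by (simp add: SO3_def orthogonal_matrix_def)
  ultimately show "\<exists>B\<in>carrier SO3. B \<otimes>\<^bsub>SO3\<^esub> A = \<one>\<^bsub>SO3\<^esub>"
    by blast
qed (auto simp: SO3_def rotation_matrix_def orthogonal_matrix_mul det_mul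
       matrix_mul_assoc orthogonal_matrix_id)

lemma rot_in_SO3:
  "rot_x \<theta> \<in> carrier SO3" "rot_y \<theta> \<in> carrier SO3" "rot_z \<theta> \<in> carrier SO3"
proof -
  have sc: "sin \<theta> * sin \<theta> + cos \<theta> * cos \<theta> = 1" "cos \<theta> * cos \<theta> + sin \<theta> * sin \<theta> = 1"
    using sin_cos_squared_add[of \<theta>] by (simp_all add: power2_eq_square)
  show "rot_x \<theta> \<in> carrier SO3" "rot_y \<theta> \<in> carrier SO3" "rot_z \<theta> \<in> carrier SO3"
    by (simp_all add: SO3_def rotation_matrix_def orthogonal_matrix rot_x_def rot_y_def
        rot_z_def det_3 vec_eq_iff forall_3 matrix_matrix_mult_def transpose_def mat_def
        sum_3 sc)
qed

end

theory Submission
  imports Defs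
begin

text \<open>Put \<open>t = exp (\<i>\<omega>)\<close> and let \<open>w\<close> be a reduced word of length \<open>n > 0\<close>. In suitable
  coordinates \<open>(2t)\<^sup>n w\<close> has entries in \<open>\<int>[t]\<close>. Its coefficient at \<open>t\<^sup>2\<^sup>n\<close> is the product of
  the leading matrices of the letters, each of rank one, and two of these multiply to zero
  only if their letters are mutually inverse. So \<open>w = 1\<close> would give a nontrivial algebraic
  equation for \<open>t\<close>, of degree \<open>2n\<close>.\<close>

section \<open>Inverses and conjugates of the rotations\<close>

lemma inv_rot_SO3:
  "inv\<^bsub>SO3\<^esub> (rot_x \<theta>) = rot_x (- \<theta>)"
  "inv\<^bsub>SO3\<^esub> (rot_y \<theta>) = rot_y (- \<theta>)"
  "inv\<^bsub>SO3\<^esub> (rot_z \<theta>) = rot_z (- \<theta>)"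
proof -
  interpret group SO3 by (rule group_SO3)
  have sc: "sin \<theta> * sin \<theta> + cos \<theta> * cos \<theta> = 1" "cos \<theta> * cos \<theta> + sin \<theta> * sin \<theta> = 1"
    using sin_cos_squared_add[of \<theta>] by (simp_all add: power2_eq_square)
  note rot_simps = SO3_def rot_x_def rot_y_def rot_z_def vec_eq_iff forall_3
    matrix_matrix_mult_def mat_def sum_3 sc
  show "inv\<^bsub>SO3\<^esub> (rot_x \<theta>) = rot_x (- \<theta>)"
    by (rule inv_equality[OF _ rot_in_SO3(1) rot_in_SO3(1)]) (simp add: rot_simps)
  show "inv\<^bsub>SO3\<^esub> (rot_y \<theta>) = rot_y (- \<theta>)"
    by (rule inv_equality[OF _ rot_in_SO3(2) rot_in_SO3(2)]) (simp add: rot_simps)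
  show "inv\<^bsub>SO3\<^esub> (rot_z \<theta>) = rot_z (- \<theta>)"
    by (rule inv_equality[OF _ rot_in_SO3(3) rot_in_SO3(3)]) (simp add: rot_simps)
qed

text \<open>The inverse of \<open>rot_y (pi / 2)\<close> carries the x-axis to the z-axis, so
  conjugation moves the axis of rotation accordingly and keeps the angle.\<close>

lemma rot_y_conj_rot_x:
  "inv\<^bsub>SO3\<^esub> (rot_y (pi / 2)) \<otimes>\<^bsub>SO3\<^esub> rot_x \<theta> \<otimes>\<^bsub>SO3\<^esub> rot_y (pi / 2) = rot_z \<theta>"
  unfolding inv_rot_SO3
  by (simp add: SO3_def rot_x_def rot_y_def rot_z_def vec_eq_iff forall_3
      matrix_matrix_mult_def sum_3)

text \<open>Cosine is even and sine odd, so inverting a letter only flips this sign in front of the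
  sine terms. It is complex so that it can scale polynomial coefficients.\<close>

definition letter_sign :: "'a letter \<Rightarrow> complex" where
  "letter_sign l = (if snd l then 1 else - 1)"

lemma eval_letter_rot:
  "eval_letter SO3 (rot_x \<theta>, b) = rot_x (if b then \<theta> else - \<theta>)"
  "eval_letter SO3 (rot_z \<theta>, b) = rot_z (if b then \<theta> else - \<theta>)"
  by (simp_all add: eval_letter_def inv_rot_SO3)

section \<open>Coordinates of rotated vectors as integer polynomials in t\<close>

lemma rot_mult_vec:
  "(rot_x \<theta> *v v) $ 1 = v $ 1"
  "(rot_x \<theta> *v v) $ 2 = cos \<theta> * v $ 2 - sin \<theta> * v $ 3"
  "(rot_x \<theta> *v v) $ 3 = sin \<theta> * v $ 2 + cos \<theta> * v $ 3"
  "(rot_z \<theta> *v v) $ 1 = cos \<theta> * v $ 1 - sin \<theta> * v $ 2"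
  "(rot_z \<theta> *v v) $ 2 = sin \<theta> * v $ 1 + cos \<theta> * v $ 2"
  "(rot_z \<theta> *v v) $ 3 = v $ 3"
  by (simp_all add: rot_x_def rot_z_def matrix_vector_mult_def sum_3)

text \<open>As 1/t = cos - i sin, the sum and difference of t and 1/t are 2 cos and 2 i sin;
  multiplying by t clears the denominator.\<close>

lemma exp_ii_cos_sin:
  fixes \<omega> :: real
  defines "t \<equiv> exp (\<i> * complex_of_real \<omega>)"
  shows "2 * t * complex_of_real (cos \<omega>) = t\<^sup>2 + 1"
    and "2 * t * (\<i> * complex_of_real (sin \<omega>)) = t\<^sup>2 - 1"
proof -
  have t: "t = complex_of_real (cos \<omega>) + \<i> * complex_of_real (sin \<omega>)"
    by (simp add: t_def exp_Euler cos_of_real sin_of_real)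
  have sc: "complex_of_real (cos \<omega>) * complex_of_real (cos \<omega>)
      + complex_of_real (sin \<omega>) * complex_of_real (sin \<omega>) = 1"
    using sin_cos_squared_add[of \<omega>]
    by (simp add: power2_eq_square add.commute flip: of_real_mult of_real_add)
  show "2 * t * complex_of_real (cos \<omega>) = t\<^sup>2 + 1"
    "2 * t * (\<i> * complex_of_real (sin \<omega>)) = t\<^sup>2 - 1"
    unfolding t power2_eq_square using sc i_squared by algebra+
qed

text \<open>In the coordinates \<open>(\<i>x, y, \<i>z)\<close>, the matrices of \<open>2tX\<close>, \<open>2tV\<close> and of their
  counterparts for the inverse rotations have entries in \<open>\<int>[t]\<close>, where \<open>t = exp (\<i>\<omega>)\<close>.\<close>

definition int_poly_coords :: "complex \<Rightarrow> nat \<Rightarrow> real^3 \<Rightarrow>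
    complex poly \<Rightarrow> complex poly \<Rightarrow> complex poly \<Rightarrow> bool" where
  "int_poly_coords t n v p q r \<longleftrightarrow>
     (\<forall>i. coeff p i \<in> \<int> \<and> coeff q i \<in> \<int> \<and> coeff r i \<in> \<int>) \<and>
     (\<forall>i > 2 * n. coeff p i = 0 \<and> coeff q i = 0 \<and> coeff r i = 0) \<and>
     poly p t = (2 * t) ^ n * (\<i> * complex_of_real (v $ 1)) \<and>
     poly q t = (2 * t) ^ n * complex_of_real (v $ 2) \<and>
     poly r t = (2 * t) ^ n * (\<i> * complex_of_real (v $ 3))"

text \<open>One letter, scaled by 2t, replaces its cosine by t^2 + 1 and i times its sine by e (t^2
  - 1); \<open>u\<close> is multiplication by the square of the variable. The factors i in the first
  and third coordinates turn every sine into i sin, so the coefficients stay integers.\<close>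

lemma int_poly_coords_step:
  fixes \<omega> :: real
  defines "t \<equiv> exp (\<i> * complex_of_real \<omega>)"
  assumes pqr: "int_poly_coords t n v p q r"
    and e: "e = (if b then 1 else - 1)"
    and \<theta>: "\<theta> = (if b then \<omega> else - \<omega>)"
  defines "u \<equiv> \<lambda>f. pCons 0 (pCons 0 f)"
  shows "int_poly_coords t (Suc n) (rot_x \<theta> *v v)
      (pCons 0 (smult 2 p)) (u q + q + smult e (u r - r)) (smult e (u q - q) + u r + r)"
    and "int_poly_coords t (Suc n) (rot_z \<theta> *v v)
      (u p + p - smult e (u q - q)) (u q + q - smult e (u p - p)) (pCons 0 (smult 2 r))"
proof -
  define C where "C = complex_of_real (cos \<omega>)"
  define D where "D = \<i> * complex_of_real (sin \<omega>)"
  have cs: "2 * t * C = t\<^sup>2 + 1" "2 * t * D = t\<^sup>2 - 1"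
    using exp_ii_cos_sin[of \<omega>] by (simp_all add: t_def C_def D_def)
  have c: "complex_of_real (cos \<theta>) = C"
    by (simp add: \<theta> C_def)
  have s: "complex_of_real (sin \<theta>) = - \<i> * e * D"
    by (simp add: \<theta> e D_def)
  have ints': "coeff (pCons 0 (smult 2 f)) i \<in> \<int>" if "\<And>i. coeff f i \<in> \<int>" for f i
    using that by (auto simp: coeff_pCons split: nat.split)
  have ints: "coeff (u f + f + smult e (u g - g)) i \<in> \<int>"
    "coeff (smult e (u f - f) + u g + g) i \<in> \<int>"
    "coeff (u f + f - smult e (u g - g)) i \<in> \<int>"
    if "\<And>i. coeff f i \<in> \<int>" "\<And>i. coeff g i \<in> \<int>" for f g i
    using that by (auto simp: u_def e coeff_pCons split: nat.split)
  have deg': "coeff (pCons 0 (smult 2 f)) i = 0"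
    if "\<And>i. i > 2 * n \<Longrightarrow> coeff f i = 0" "i > 2 * Suc n" for f i
    using that by (auto simp: coeff_pCons split: nat.split)
  have deg: "coeff (u f + f + smult e (u g - g)) i = 0"
    "coeff (smult e (u f - f) + u g + g) i = 0"
    "coeff (u f + f - smult e (u g - g)) i = 0"
    if "\<And>i. i > 2 * n \<Longrightarrow> coeff f i = 0" "\<And>i. i > 2 * n \<Longrightarrow> coeff g i = 0" "i > 2 * Suc n" for f g i
    using that by (auto simp: u_def coeff_pCons split: nat.split)
  note pqr' = pqr[unfolded int_poly_coords_def]
  have p: "poly p t = (2 * t) ^ n * (\<i> * complex_of_real (v $ 1))"
    and q: "poly q t = (2 * t) ^ n * complex_of_real (v $ 2)"
    and r: "poly r t = (2 * t) ^ n * (\<i> * complex_of_real (v $ 3))"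
    using pqr' by auto
  have u: "poly (u f) t = t\<^sup>2 * poly f t" for f
    by (simp add: u_def power2_eq_square algebra_simps)
  have plus: "poly (u f + f) t = 2 * t * C * poly f t" for f
    unfolding cs by (simp add: u algebra_simps)
  have minus: "poly (u f - f) t = 2 * t * D * poly f t" for f
    unfolding cs by (simp add: u algebra_simps)
  have i: "\<i> * (\<i> * a) = - a" for a
    by (simp flip: mult.assoc)
  note ev = p q r c s rot_mult_vec
  show "int_poly_coords t (Suc n) (rot_x \<theta> *v v)
      (pCons 0 (smult 2 p)) (u q + q + smult e (u r - r)) (smult e (u q - q) + u r + r)"
    unfolding int_poly_coords_def
  proof (intro conjI allI impI)
    show "poly (u q + q + smult e (u r - r)) t
      = (2 * t) ^ Suc n * complex_of_real ((rot_x \<theta> *v v) $ 2)"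
      unfolding poly_add[of "u q + q"] poly_smult plus minus
      by (simp add: ev i algebra_simps)
    show "poly (smult e (u q - q) + u r + r) t
      = (2 * t) ^ Suc n * (\<i> * complex_of_real ((rot_x \<theta> *v v) $ 3))"
      unfolding add.assoc poly_add[of "smult e (u q - q)"] poly_smult plus minus
      by (simp add: ev i algebra_simps)
  qed (use pqr' in \<open>simp_all add: ints ints' deg deg' rot_mult_vec del: coeff_add coeff_diff coeff_smult\<close>)
  show "int_poly_coords t (Suc n) (rot_z \<theta> *v v)
      (u p + p - smult e (u q - q)) (u q + q - smult e (u p - p)) (pCons 0 (smult 2 r))"
    unfolding int_poly_coords_def
  proof (intro conjI allI impI)
    show "poly (u p + p - smult e (u q - q)) t
      = (2 * t) ^ Suc n * (\<i> * complex_of_real ((rot_z \<theta> *v v) $ 1))"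
      unfolding poly_diff[of "u p + p"] poly_smult plus minus
      by (simp add: ev i algebra_simps)
    show "poly (u q + q - smult e (u p - p)) t
      = (2 * t) ^ Suc n * complex_of_real ((rot_z \<theta> *v v) $ 2)"
      unfolding poly_diff[of "u q + q"] poly_smult plus minus
      by (simp add: ev i algebra_simps)
  qed (use pqr' in \<open>simp_all add: ints ints' deg deg' rot_mult_vec del: coeff_add coeff_diff coeff_smult\<close>)
qed

section \<open>Leading coefficients of reduced words\<close>

text \<open>The prescribed top coefficients say that the leading vector is an eigenvector of the leading
  matrix of the first letter; only the leading matrix of the inverse letter annihilates it.\<close>

lemma reduced_rot_word_polys:
  fixes \<omega> :: real
  defines "t \<equiv> exp (\<i> * complex_of_real \<omega>)"
    and "X \<equiv> rot_x \<omega>" and "V \<equiv> rot_z \<omega>"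
  assumes "X \<noteq> V"
    and "w \<in> lists ({X, V} \<times> UNIV)" and "reduced_word w"
  shows "\<exists>p q r. int_poly_coords t (length w) (eval_word SO3 w *v axis 2 1) p q r \<and>
    coeff q (2 * length w) \<noteq> 0 \<and>
    (coeff p (2 * length w), coeff r (2 * length w)) =
      (case w of [] \<Rightarrow> (0, 0)
       | l # _ \<Rightarrow> if fst l = X then (0, letter_sign l * coeff q (2 * length w))
                  else (- letter_sign l * coeff q (2 * length w), 0))"
  using assms(5,6)
proof (induction w)
  case Nil
  \<comment> \<open>The y-axis is orthogonal to both rotation axes, so no leading matrix annihilates
    the starting vector.\<close>
  have "int_poly_coords t 0 (axis 2 1) 0 1 0"
    by (auto simp: int_poly_coords_def axis_def)
  then show ?case
    by (intro exI[of _ 0] exI[of _ 1]) (simp add: eval_word_def SO3_def)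
next
  case (Cons l w)
  obtain Y b where l: "l = (Y, b)" by (cases l)
  define n where "n = length w"
  define v where "v = eval_word SO3 w *v axis 2 1"
  define e where "e = letter_sign l"
  define u where "u = (\<lambda>f :: complex poly. pCons 0 (pCons 0 f))"
  have e: "e = (if b then 1 else - 1)"
    by (simp add: e_def l letter_sign_def)
  have "reduced_word w" and hd: "w = [] \<or> hd w \<noteq> inv_letter l"
    using Cons.prems by (auto simp: reduced_Cons)
  then obtain p q r where pqr: "int_poly_coords t n v p q r" and q0: "coeff q (2 * n) \<noteq> 0"
    and pr: "(coeff p (2 * n), coeff r (2 * n)) =
      (case w of [] \<Rightarrow> (0, 0)
       | l # _ \<Rightarrow> if fst l = X then (0, letter_sign l * coeff q (2 * n))
                  else (- letter_sign l * coeff q (2 * n), 0))"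
    using Cons.IH unfolding n_def v_def by blast
  note step = int_poly_coords_step[OF pqr[unfolded t_def] e refl, folded t_def u_def]
  have ev: "eval_word SO3 (l # w) *v axis 2 1 = eval_letter SO3 l *v v"
    by (simp add: eval_word_def v_def SO3_def matrix_vector_mul_assoc)
  have len: "length (l # w) = Suc n"
    by (simp add: n_def)
  \<comment> \<open>Hence only the terms shifted by \<open>u\<close> reach degree 2n + 2, and the
    coordinate along the rotation axis, merely multiplied by 2t, has top coefficient 0.\<close>
  have top: "coeff f (Suc (2 * n)) = 0" "coeff f (Suc (Suc (2 * n))) = 0" if "f \<in> {p, q, r}" for f
    using pqr that by (auto simp: int_poly_coords_def)
  have w: "w \<in> lists ({X, V} \<times> UNIV)"
    using Cons.hyps by simp
  consider "Y = X" | "Y = V" "Y \<noteq> X"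
    using Cons.hyps \<open>X \<noteq> V\<close> by (auto simp: l)
  then show ?case
  proof cases
    case 1
    have L: "eval_letter SO3 l = rot_x (if b then \<omega> else - \<omega>)"
      by (simp add: l 1 X_def eval_letter_rot)
    \<comment> \<open>This is the new top coefficient of the y-coordinate. If \<open>w\<close> is
      empty or starts with a power of V, the \<open>r\<close> term vanishes. Otherwise reducedness
      forces the same sign e, and the two terms are equal.\<close>
    have nz: "coeff q (2 * n) + e * coeff r (2 * n) \<noteq> 0"
      using pr hd q0 1 by (auto simp: e letter_sign_def inv_letter_def l prod_eq_iff
          split: list.splits if_splits)
    show ?thesis
      unfolding ev len L
      by (rule exI, rule exI, rule exI, rule conjI[OF step(1)])
        (use nz in \<open>auto simp: l 1 top e u_def letter_sign_def\<close>)
  next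
    case 2
    have L: "eval_letter SO3 l = rot_z (if b then \<omega> else - \<omega>)"
      by (simp add: l 2 V_def eval_letter_rot)
    \<comment> \<open>The same with X and V exchanged; here \<open>w\<close> ensures that a first
      letter other than a power of X is a power of V.\<close>
    have nz: "coeff q (2 * n) - e * coeff p (2 * n) \<noteq> 0"
      using pr hd q0 2 w by (auto simp: e letter_sign_def inv_letter_def l prod_eq_iff
          split: list.splits if_splits)
    show ?thesis
      unfolding ev len L
      by (rule exI, rule exI, rule exI, rule conjI[OF step(2)])
        (use nz in \<open>auto simp: l 2 \<open>X \<noteq> V\<close>[symmetric] top e u_def letter_sign_def\<close>)
  qed
qed

section \<open>Absence of relations and freeness\<close>

lemma reduced_rot_word_eq_one:
  fixes \<omega> :: real
  assumes tr: "\<not> algebraic (exp (\<i> * complex_of_real \<omega>))"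
    and ne: "rot_x \<omega> \<noteq> rot_z \<omega>"
    and w: "w \<in> lists ({rot_x \<omega>, rot_z \<omega>} \<times> UNIV)" "reduced_word w"
    and one: "eval_word SO3 w = \<one>\<^bsub>SO3\<^esub>"
  shows "w = []"
proof (rule ccontr)
  assume "w \<noteq> []"
  define n where "n = length w"
  have n: "n > 0" using \<open>w \<noteq> []\<close> by (simp add: n_def)
  define t where "t = exp (\<i> * complex_of_real \<omega>)"
  obtain p q r where pqr: "int_poly_coords t n (eval_word SO3 w *v axis 2 1) p q r"
    and q0: "coeff q (2 * n) \<noteq> 0"
    using reduced_rot_word_polys[OF ne w] unfolding t_def n_def by blast
  have "algebraic t"
  proof (rule algebraicI)
    \<comment> \<open>If the word is the identity, the y-coordinate stays 1 and q(t) = (2t)^n.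
      Subtracting this monomial leaves the coefficient at 2n intact, since n > 0 gives n <
      2n.\<close>
    show "coeff (q - monom (2 ^ n) n) i \<in> \<int>" for i
      using pqr by (auto simp: int_poly_coords_def)
    have "coeff (q - monom (2 ^ n) n) (2 * n) \<noteq> 0"
      using q0 n by simp
    then show "q - monom (2 ^ n) n \<noteq> 0" by (metis coeff_0)
    show "poly (q - monom (2 ^ n) n) t = 0"
      using pqr one by (simp add: int_poly_coords_def SO3_def axis_def poly_monom power_mult_distrib)
  qed
  with tr show False by (simp add: t_def)
qed

lemma rot_x_neq_rot_z:
  assumes "\<not> algebraic (exp (\<i> * complex_of_real \<omega>))"
  shows "rot_x \<omega> \<noteq> rot_z \<omega>"
proof
  assume "rot_x \<omega> = rot_z \<omega>"
  then have "rot_x \<omega> $ 1 $ 1 = rot_z \<omega> $ 1 $ 1" "rot_x \<omega> $ 1 $ 2 = rot_z \<omega> $ 1 $ 2"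
    by simp_all
  then have "cos \<omega> = 1" "sin \<omega> = 0" by (simp_all add: rot_x_def rot_z_def)
  then have "exp (\<i> * complex_of_real \<omega>) = 1"
    by (simp add: exp_Euler cos_of_real sin_of_real)
  with assms show False by simp
qed

text \<open>A trivial kernel makes evaluation injective; its image is a subgroup containing
  \<open>B\<close>, hence everything.\<close>

lemma (in group) is_free_group_on_generated:
  assumes B: "B \<subseteq> carrier G"
    and inj: "\<And>w. w \<in> carrier (free_group B) \<Longrightarrow> eval_word G w = \<one> \<Longrightarrow> w = []"
  shows "is_free_group_on (subgroup_generated G B) B"
proof -
  let ?H = "subgroup_generated G B"
  interpret H: group ?H by (rule group_subgroup_generated)
  have BH: "B \<subseteq> carrier ?H"
    using B by (simp add: generate.incl subgroup_generated_def subset_iff)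
  have lists: "eval_word ?H w = eval_word G w" if "w \<in> lists (B \<times> UNIV)" for w
    using that
  proof induction
    case (Cons l w)
    then have "eval_letter ?H l = eval_letter G l"
      using BH by (auto simp: eval_letter_def)
    with Cons show ?case by (simp add: eval_word_def)
  qed (simp add: eval_word_def)
  interpret h: group_hom "free_group B" ?H "eval_word ?H"
    using H.eval_word_hom[OF BH]
    by (simp add: group_hom_def group_hom_axioms_def group_free_group H.group_axioms)
  have ker: "w = \<one>\<^bsub>free_group B\<^esub>"
    if "w \<in> carrier (free_group B)" "eval_word ?H w = \<one>\<^bsub>?H\<^esub>" for w
    using that inj lists by (simp add: free_group_def del: in_lists_conv_set)
  have "b \<in> eval_word ?H ` carrier (free_group B)" if "b \<in> B" for b
    using that BH H.eval_word_generator[of b]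
    by (intro image_eqI[of _ _ "[(b, True)]"]) (auto simp: free_group_def reduced_Cons)
  then have "generate ?H B \<subseteq> eval_word ?H ` carrier (free_group B)"
    by (intro H.generate_subgroup_incl h.img_is_subgroup) auto
  \<comment> \<open>The carrier is defined by generation in \<open>G\<close>; generating inside the
    subgroup gives the same set.\<close>
  moreover have "carrier ?H = generate ?H B"
    using generate_consistent[OF _ generate_is_subgroup[OF B], of B] B
    by (auto simp: subgroup_generated_def Int_absorb1 intro: generate.incl)
  ultimately show ?thesis
    using BH ker by (simp add: is_free_group_on_def h.iso_iff)
qed

theorem theorem5:
  fixes \<omega> :: real and S X V :: "real^3^3"
  assumes "\<not> algebraic (exp (\<i> * complex_of_real \<omega>))"
    and "S = rot_y (pi / 2)"
    and "X = rot_x \<omega>"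
    and "V = inv\<^bsub>SO3\<^esub> S \<otimes>\<^bsub>SO3\<^esub> X \<otimes>\<^bsub>SO3\<^esub> S"
  shows "V = rot_z \<omega> \<and> X \<noteq> V \<and>
    is_free_group_on (subgroup_generated SO3 {X, V}) {X, V}"
proof -
  have V: "V = rot_z \<omega>"
    using assms(2-4) rot_y_conj_rot_x by simp
  \<comment> \<open>Distinctness makes the rank two: otherwise \<open>{X, V}\<close> would be a
    singleton.\<close>
  have XV: "X \<noteq> V"
    using rot_x_neq_rot_z[OF assms(1)] by (simp add: V assms(3))
  have "is_free_group_on (subgroup_generated SO3 {X, V}) {X, V}"
  proof (rule group.is_free_group_on_generated[OF group_SO3])
    show "{X, V} \<subseteq> carrier SO3"
      by (simp add: V assms(3) rot_in_SO3)
    fix w assume "w \<in> carrier (free_group {X, V})" "eval_word SO3 w = \<one>\<^bsub>SO3\<^esub>"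
    then show "w = []"
      using reduced_rot_word_eq_one[OF assms(1)] XV
      by (simp add: V assms(3) free_group_def del: in_lists_conv_set)
  qed
  with V XV show ?thesis by simp
qed

end
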